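(* Let $P\ge 1$ and $L\ge 2$ be integers and let $\Omega:=[0,1]^{P\times L}\times[0,1]^{P\times L}$. There exists a continuous function $s:\Omega\to\mathbb{R}$ such that, for every positive integer $O\le P\cdot L-1$ and any mappings $h_1,h_2:\mathbb{R}^{P\times L}\to\mathbb{R}^O$, $$\int_\Omega\left(h_1(\mathbf{X})^\top h_2(\mathbf{Y})-s(\mathbf{X},\mathbf{Y})\right)^2\,{\rm d}(\mathbf{X},\mathbf{Y})\ge\frac{1}{20}.$$
   Context: $[0,1]^{P\times L}$ is the set of $P\times L$ real matrices with entries in $[0,1]$; integration is with respect to Lebesgue measure. The function $s$ is a ground-truth query-document scoring function; each query $\mathbf{X}$ and document $\mathbf{Y}$ consists of $L$ tokens of dimension $P$, and $h_1,h_2$ are the query and document encoders of a dot-product dual encoder with embedding dimension $O$. *)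

theory Defs
  imports "HOL-Analysis.Analysis" "Jordan_Normal_Form.Matrix"
begin

text \<open>
  A \<open>P \<times> L\<close> real matrix (\<open>P\<close> rows, \<open>L\<close> columns) is an element of \<^typ>\<open>real ^ 'l ^ 'p\<close> with
  \<open>P = CARD('p)\<close> and \<open>L = CARD('l)\<close>; a vector in \<open>\<real>\<^sup>n\<close> for a bound natural number \<open>n\<close> is an
  element of \<open>carrier_vec n\<close>.
\<close>

definition unit_matrices :: "(real ^ 'l ^ 'p) set" where
  "unit_matrices = {X. \<forall>i j. vec_nth (vec_nth X i) j \<in> {0..1}}"

definition Omega :: "((real ^ 'l ^ 'p) \<times> (real ^ 'l ^ 'p)) set" where
  "Omega = unit_matrices \<times> unit_matrices"

text \<open>
  The encoders are arbitrary mappings, so the squared error need not be measurable. For such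
  integrands \<^const>\<open>nn_integral\<close> is only a lower integral (a supremum over simple minorants) and
  \<^const>\<open>lebesgue_integral\<close> is \<open>0\<close>. We use the upper integral, which is defined for every
  nonnegative function and is the Lebesgue integral (possibly \<open>\<infinity>\<close>) whenever the integrand is
  measurable, as the two lemmas below show.
\<close>

definition upper_nn_integral :: "'a measure \<Rightarrow> ('a \<Rightarrow> ennreal) \<Rightarrow> ennreal" where
  "upper_nn_integral M f =
     (INF g \<in> {g \<in> borel_measurable M. \<forall>x \<in> space M. f x \<le> g x}. nn_integral M g)"

lemma upper_nn_integral_eq_nn_integral:
  assumes "f \<in> borel_measurable M"
  shows "upper_nn_integral M f = nn_integral M f"
  unfolding upper_nn_integral_def
proof (rule antisym)
  show "(INF g \<in> {g \<in> borel_measurable M. \<forall>x \<in> space M. f x \<le> g x}. nn_integral M g)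
      \<le> nn_integral M f"
    by (rule INF_lower) (use assms in auto)
  show "nn_integral M f
      \<le> (INF g \<in> {g \<in> borel_measurable M. \<forall>x \<in> space M. f x \<le> g x}. nn_integral M g)"
    by (rule INF_greatest) (auto intro: nn_integral_mono)
qed

lemma upper_nn_integral_eq_integral:
  fixes f :: "'a \<Rightarrow> real"
  assumes "integrable M f" "\<And>x. 0 \<le> f x"
  shows "upper_nn_integral M (\<lambda>x. ennreal (f x)) = ennreal (integral\<^sup>L M f)"
proof -
  have "(\<lambda>x. ennreal (f x)) \<in> borel_measurable M"
    using assms(1) by measurable
  then show ?thesis
    using assms by (simp add: upper_nn_integral_eq_nn_integral nn_integral_eq_integral)
qed

end

theory Submission
  imports Defs
begin

text \<open>
  Let \<open>N = P L\<close>, take \<open>s = K \<langle>X, Y\<rangle>\<close> with \<open>K\<close> large, and look at the \<open>N \<times> N\<close> grid of points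
  \<open>(a/2 + u, b/2 + w)\<close>, where \<open>a, b\<close> run through the standard basis and \<open>u, w\<close> are small. On such
  a grid \<open>s\<close> is a strictly diagonally dominant matrix, whereas a dual encoder of dimension less
  than \<open>N\<close> gives a singular one; hence the two differ by a fixed multiple of \<open>K\<close> at some grid point.
  Summing over the grid and integrating over all small \<open>(u, w)\<close> bounds the squared error from below
  by a multiple of \<open>K\<^sup>2\<close>.
\<close>

text \<open>Fewer equations than unknowns: the \<open>n\<close> coefficient rows, read as vectors,
  span a subspace of dimension at most \<open>n\<close>, so some nonzero \<open>c\<close> is
  orthogonal to all of them. The unknowns are the coordinates of \<open>c\<close>, which fits
  matrices indexed by \<open>Basis\<close>.\<close>

lemma nontrivial_solution_Basis:
  fixes g :: "nat \<Rightarrow> 'a::euclidean_space \<Rightarrow> real"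
  assumes "n < DIM('a)"
  obtains c :: 'a where "c \<noteq> 0" "\<And>k. k < n \<Longrightarrow> (\<Sum>b\<in>Basis. inner c b * g k b) = 0"
proof -
  define v where "v k = (\<Sum>b\<in>Basis. g k b *\<^sub>R b)" for k
  have "dim (v ` {..<n}) \<le> card (v ` {..<n})"
    by (rule dim_le_card') simp
  also have "\<dots> \<le> n"
    using card_image_le[of "{..<n}" v] by simp
  finally have "dim (v ` {..<n}) < DIM('a)"
    using assms by simp
  then obtain c where c: "c \<noteq> 0" "\<And>y. y \<in> span (v ` {..<n}) \<Longrightarrow> inner c y = 0"
    using orthogonal_to_subspace_exists unfolding Linear_Algebra.orthogonal_def by blast
  show thesis
  proof (rule that[OF c(1)])
    fix k assume "k < n"
    then have "inner c (v k) = 0"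
      by (intro c(2) span_base) simp
    then show "(\<Sum>b\<in>Basis. inner c b * g k b) = 0"
      by (simp add: v_def inner_sum_right mult.commute)
  qed
qed

text \<open>The matrix of sums over \<open>k<n\<close> has rank at most \<open>n\<close>, hence a
  kernel vector \<open>c\<close>. If it were within \<open>e\<close> of \<open>A\<close> everywhere,
  it would inherit enough diagonal dominance from \<open>A\<close> to be nonsingular.\<close>

lemma low_rank_far_from_diagonally_dominant:
  fixes f g :: "nat \<Rightarrow> 'a::euclidean_space \<Rightarrow> real" and A :: "'a \<Rightarrow> 'a \<Rightarrow> real"
  assumes n: "n < DIM('a)" and e: "e > 0" and de: "2 * real (DIM('a)) * e \<le> d"
    and diag: "\<And>b. b \<in> Basis \<Longrightarrow> d \<le> A b b"
    and off: "\<And>a b. a \<in> Basis \<Longrightarrow> b \<in> Basis \<Longrightarrow> a \<noteq> b \<Longrightarrow> \<bar>A a b\<bar> \<le> e"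
  shows "\<exists>a\<in>Basis. \<exists>b\<in>Basis. e \<le> \<bar>(\<Sum>k<n. f k a * g k b) - A a b\<bar>"
proof (rule ccontr)
  define F where "F a b = (\<Sum>k<n. f k a * g k b)" for a b
  assume "\<not> ?thesis"
  then have close: "\<bar>F a b - A a b\<bar> < e" if "a \<in> Basis" "b \<in> Basis" for a b
    using that by (force simp: F_def)
  obtain c :: 'a where c0: "c \<noteq> 0" and c: "\<And>k. k < n \<Longrightarrow> (\<Sum>b\<in>Basis. inner c b * g k b) = 0"
    using nontrivial_solution_Basis[OF n] by metis
  have ker: "(\<Sum>b\<in>Basis. inner c b * F a b) = 0" for a
  proof -
    have "(\<Sum>b\<in>Basis. inner c b * F a b) = (\<Sum>k<n. f k a * (\<Sum>b\<in>Basis. inner c b * g k b))"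
      unfolding F_def sum_distrib_left
      by (subst sum.swap) (simp add: mult_ac)
    then show ?thesis
      using c by simp
  qed
  \<comment> \<open>Row \<open>m\<close>, where \<open>c\<close> has its largest coordinate in
    absolute value, gives the contradiction: there the diagonal entry is at most the sum of the
    absolute values of the others.\<close>
  obtain m where m: "m \<in> Basis" and meq: "Max ((\<lambda>b. \<bar>inner c b\<bar>) ` Basis) = \<bar>inner c m\<bar>"
    by (rule obtains_MAX[OF finite_Basis nonempty_Basis])
  have max: "\<bar>inner c b\<bar> \<le> \<bar>inner c m\<bar>" if "b \<in> Basis" for b
    unfolding meq[symmetric] using that by (intro Max_ge) auto
  have cm: "\<bar>inner c m\<bar> > 0"
  proof (rule ccontr)
    assume "\<not> \<bar>inner c m\<bar> > 0"
    then have "\<forall>b\<in>Basis. inner c b = 0"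
      using max by fastforce
    then show False
      using c0 euclidean_all_zero_iff by blast
  qed
  have small: "\<bar>F m b\<bar> \<le> 2 * e" if "b \<in> Basis - {m}" for b
    using close[of m b] off[of m b] that m by (auto simp: abs_if split: if_splits)
  have "inner c m * F m m = - (\<Sum>b\<in>Basis - {m}. inner c b * F m b)"
    using ker[of m] sum.remove[OF finite_Basis m, of "\<lambda>b. inner c b * F m b"] by simp
  then have "\<bar>inner c m\<bar> * \<bar>F m m\<bar> = \<bar>\<Sum>b\<in>Basis - {m}. inner c b * F m b\<bar>"
    by (metis abs_minus_cancel abs_mult)
  also have "\<dots> \<le> (\<Sum>b\<in>Basis - {m}. \<bar>inner c m\<bar> * (2 * e))"
    by (rule order_trans[OF sum_abs], rule sum_mono)
      (use max small in \<open>auto simp: abs_mult intro!: mult_mono\<close>)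
  also have "\<dots> = \<bar>inner c m\<bar> * ((real (DIM('a)) - 1) * (2 * e))"
    using m by (simp add: of_nat_diff Suc_le_eq)
  finally have "\<bar>F m m\<bar> \<le> (real (DIM('a)) - 1) * (2 * e)"
    using cm by simp
  \<comment> \<open>Closeness to \<open>A m m\<close> would instead force \<open>F m m\<close> above
    \<open>d - e\<close>.\<close>
  then have "\<bar>F m m\<bar> \<le> d - 2 * e"
    using de by (simp add: algebra_simps)
  then show False
    using close[OF m m] diag[OF m] e by linarith
qed

lemma lebesgue_measurable_add:
  fixes a :: "'a::euclidean_space"
  shows "(\<lambda>x. a + x) \<in> lebesgue \<rightarrow>\<^sub>M lebesgue"
  using lebesgue_affine_measurable[of "\<lambda>_. 1" a] by (simp add: euclidean_representation)

text \<open>A translation is an affine map with all scaling factors 1, so its density factor is 1.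
  The statement is for \<open>lebesgue\<close> rather than \<open>lborel\<close> because the
  majorants in the upper integral are only Lebesgue measurable.\<close>

lemma nn_integral_lebesgue_translation:
  fixes f :: "'a::euclidean_space \<Rightarrow> ennreal"
  assumes "f \<in> borel_measurable lebesgue"
  shows "(\<integral>\<^sup>+ x. f (a + x) \<partial>lebesgue) = (\<integral>\<^sup>+ x. f x \<partial>lebesgue)"
proof -
  have "(lebesgue :: 'a measure) = density (distr lebesgue lebesgue (\<lambda>x. a + x)) (\<lambda>_. 1)"
    using lebesgue_affine_euclidean[of "\<lambda>_. 1" a] by (simp add: euclidean_representation)
  then have "(lebesgue :: 'a measure) = distr lebesgue lebesgue (\<lambda>x. a + x)"
    by (simp add: density_1)
  then show ?thesis
    using nn_integral_distr[OF lebesgue_measurable_add[of a], of f] assms by simp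
qed

text \<open>Integrate the pointwise bound over \<open>Q\<close>; by translation invariance every
  summand on the right contributes the same integral. The translates of \<open>Q\<close> may
  overlap, at the price of the factor \<open>card I\<close>.\<close>

lemma emeasure_le_nn_integral_translates:
  fixes g :: "'a::euclidean_space \<Rightarrow> ennreal"
  assumes g: "g \<in> borel_measurable lebesgue" and Q: "Q \<in> sets lebesgue"
    and le: "\<And>z. z \<in> Q \<Longrightarrow> \<delta> \<le> (\<Sum>i\<in>I. g (t i + z))"
  shows "\<delta> * emeasure lebesgue Q \<le> of_nat (card I) * (\<integral>\<^sup>+ x. g x \<partial>lebesgue)"
proof -
  have meas: "(\<lambda>z. g (t i + z)) \<in> borel_measurable lebesgue" for i
    using measurable_compose[OF lebesgue_measurable_add g] .
  have "\<delta> * emeasure lebesgue Q = (\<integral>\<^sup>+ z. \<delta> * indicator Q z \<partial>lebesgue)"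
    using Q by (simp add: nn_integral_cmult_indicator)
  also have "\<dots> \<le> (\<integral>\<^sup>+ z. (\<Sum>i\<in>I. g (t i + z)) \<partial>lebesgue)"
    by (rule nn_integral_mono) (auto simp: indicator_def le)
  also have "\<dots> = (\<Sum>i\<in>I. \<integral>\<^sup>+ z. g (t i + z) \<partial>lebesgue)"
    by (rule nn_integral_sum) (rule meas)
  also have "\<dots> = of_nat (card I) * (\<integral>\<^sup>+ x. g x \<partial>lebesgue)"
    by (simp add: nn_integral_lebesgue_translation[OF g])
  finally show ?thesis .
qed

text \<open>The matrix units \<open>axis i (axis j 1)\<close> form the basis, so bounds on entries
  are bounds on coordinates, and the library facts on boxes become available.\<close>

lemma unit_matrices_eq_cbox: "(unit_matrices :: (real ^ 'l ^ 'p) set) = cbox 0 One"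
proof -
  have entry: "vec_nth (vec_nth X i) j = inner X (axis i (axis j 1))" for X :: "real ^ 'l ^ 'p" and i j
    by (simp add: inner_axis)
  have Basis: "(Basis :: (real ^ 'l ^ 'p) set) = range (\<lambda>(i, j). axis i (axis j 1))"
    by (auto simp: Basis_vec_def)
  have "(\<forall>i j. vec_nth (vec_nth X i) j \<in> {0..1}) \<longleftrightarrow> (\<forall>b\<in>Basis. inner X b \<in> {0..1})"
    for X :: "real ^ 'l ^ 'p"
    unfolding Basis entry by auto
  then show ?thesis
    by (auto simp: unit_matrices_def mem_box inner_sum_left_Basis)
qed

text \<open>With side \<open>h = 1 / (16 * N)\<close> the two cross terms are at most
  \<open>h / 2\<close> each and \<open>inner u w\<close> is at most
  \<open>N * h * h = 1 / (256 * N)\<close>, while nothing is negative. The resulting bounds satisfy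
  \<open>2 * N * (1 / (8 * N)) = 1 / 4\<close>, exactly the dominance required of the grid
  matrix.\<close>

lemma inner_perturbed_Basis:
  fixes a b u w :: "'a::euclidean_space"
  assumes N: "N = real (DIM('a))" and ab: "a \<in> Basis" "b \<in> Basis"
    and u: "u \<in> cbox 0 ((1 / (16 * N)) *\<^sub>R One)" and w: "w \<in> cbox 0 ((1 / (16 * N)) *\<^sub>R One)"
  shows "a = b \<Longrightarrow> 1 / 4 \<le> inner ((1 / 2) *\<^sub>R a + u) ((1 / 2) *\<^sub>R b + w)"
    and "a \<noteq> b \<Longrightarrow> \<bar>inner ((1 / 2) *\<^sub>R a + u) ((1 / 2) *\<^sub>R b + w)\<bar> \<le> 1 / (8 * N)"
proof -
  let ?h = "1 / (16 * N)"
  have N1: "N \<ge> 1"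
    using DIM_positive[where 'a='a] by (simp add: N Suc_le_eq)
  have ub: "0 \<le> inner u b" "inner u b \<le> ?h" and wb: "0 \<le> inner w b" "inner w b \<le> ?h"
    if "b \<in> Basis" for b
    using u w that by (auto simp: mem_box inner_sum_left_Basis)
  have uw0: "0 \<le> inner u w"
    by (subst euclidean_inner) (auto intro!: sum_nonneg mult_nonneg_nonneg ub wb)
  have "inner u w \<le> (\<Sum>b\<in>(Basis :: 'a set). ?h * ?h)"
    by (subst euclidean_inner) (intro sum_mono mult_mono ub wb; use N1 in simp)
  also have "\<dots> = 1 / (256 * N)"
    using N1 by (simp add: N[symmetric])
  finally have uw: "inner u w \<le> 1 / (256 * N)" .
  have expand: "inner ((1 / 2) *\<^sub>R a + u) ((1 / 2) *\<^sub>R b + w)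
      = inner a b / 4 + inner w a / 2 + inner u b / 2 + inner u w"
    by (simp add: inner_add_left inner_add_right inner_commute)
  show "1 / 4 \<le> inner ((1 / 2) *\<^sub>R a + u) ((1 / 2) *\<^sub>R b + w)" if "a = b"
    unfolding expand using uw0 ub(1)[OF ab(2)] wb(1)[OF ab(1)] that ab by simp
  show "\<bar>inner ((1 / 2) *\<^sub>R a + u) ((1 / 2) *\<^sub>R b + w)\<bar> \<le> 1 / (8 * N)" if "a \<noteq> b"
  proof -
    have "?h / 2 + ?h / 2 + 1 / (256 * N) \<le> 1 / (8 * N)"
      using N1 by (simp add: field_simps)
    then show ?thesis
      unfolding expand using uw0 uw ub[OF ab(2)] wb[OF ab(1)] that ab
      by (simp add: inner_not_same_Basis)
  qed
qed

theorem theorem3p2: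
  assumes "CARD('p::finite) \<ge> 1" and "CARD('l::finite) \<ge> 2"
  shows "\<exists>s :: (real ^ 'l ^ 'p) \<times> (real ^ 'l ^ 'p) \<Rightarrow> real.
    continuous_on Omega s \<and>
    (\<forall>(n::nat) (h1 :: real ^ 'l ^ 'p \<Rightarrow> real Matrix.vec) (h2 :: real ^ 'l ^ 'p \<Rightarrow> real Matrix.vec).
       1 \<le> n \<longrightarrow> n \<le> CARD('p) * CARD('l) - 1 \<longrightarrow>
       h1 \<in> UNIV \<rightarrow> carrier_vec n \<longrightarrow> h2 \<in> UNIV \<rightarrow> carrier_vec n \<longrightarrow>
       upper_nn_integral (lebesgue_on Omega)
         (\<lambda>(X, Y). ennreal ((scalar_prod (h1 X) (h2 Y) - s (X, Y))\<^sup>2)) \<ge> ennreal (1 / 20))"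
proof -
  define N where "N = real (DIM(real ^ 'l ^ 'p))"
  define \<eta> where "\<eta> = 1 / (16 * N)"
  define B :: "(real ^ 'l ^ 'p) set" where "B = cbox 0 (\<eta> *\<^sub>R One)"
  define v where "v = measure lebesgue (B \<times> B)"
  define e where "e = 1 / (8 * N)"
  \<comment> \<open>Chosen so that \<open>(K * e)\<^sup>2 * v = N\<^sup>2\<close>, the number of
    grid points; this cancels the cost of summing over the grid. \<open>K\<close> depends only on
    the matrix dimensions, so \<open>s\<close> is fixed before \<open>n\<close>, \<open>h1\<close>
    and \<open>h2\<close>.\<close>
  define K where "K = N / (e * sqrt v)"
  define s where "s = (\<lambda>(X :: real ^ 'l ^ 'p, Y :: real ^ 'l ^ 'p). K * inner X Y)"
  have N1: "N \<ge> 1"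
    using DIM_positive[where 'a="real ^ 'l ^ 'p"] unfolding N_def by linarith
  have BB: "B \<times> B = cbox (0, 0) (\<eta> *\<^sub>R One, \<eta> *\<^sub>R One)"
    by (simp add: B_def cbox_Pair_eq)
  have BB_sets: "B \<times> B \<in> sets lebesgue"
    by (simp add: BB)
  have "box (0, 0) (\<eta> *\<^sub>R One :: real ^ 'l ^ 'p, \<eta> *\<^sub>R One :: real ^ 'l ^ 'p) \<noteq> {}"
    using N1 by (auto simp: box_ne_empty \<eta>_def Basis_prod_def inner_sum_left_Basis)
  then have v0: "v > 0"
    unfolding v_def BB by (simp add: content_pos_lt_eq box_ne_empty)
  have v: "emeasure lebesgue (B \<times> B) = ennreal v"
    unfolding v_def BB by (simp add: emeasure_eq_ennreal_measure emeasure_lborel_cbox_eq)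
  have e0: "e > 0"
    using N1 by (simp add: e_def)
  have K0: "K > 0"
    using N1 e0 v0 by (simp add: K_def)
  have K: "(K * e)\<^sup>2 * v = N\<^sup>2"
    using e0 v0 by (simp add: K_def power_divide power_mult_distrib)
  have Omega: "(Omega :: ((real ^ 'l ^ 'p) \<times> (real ^ 'l ^ 'p)) set) = cbox (0, 0) (One, One)"
    by (simp add: Omega_def unit_matrices_eq_cbox cbox_Pair_eq)
  have cont: "continuous_on Omega s"
    unfolding s_def case_prod_beta by (intro continuous_intros)
  \<comment> \<open>The perturbed grid stays inside the domain, since coordinates are at most
    \<open>1 / 2 + \<eta>\<close>.\<close>
  have half_mem: "(1 / 2) *\<^sub>R a + u \<in> unit_matrices" if "a \<in> Basis" "u \<in> B" for a u
  proof -
    have "\<eta> \<le> 1 / 2"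
      using N1 by (simp add: \<eta>_def field_simps)
    then show ?thesis
      using that unfolding B_def unit_matrices_eq_cbox
      by (force simp: mem_box inner_sum_left_Basis inner_add_left inner_Basis)
  qed
  \<comment> \<open>The upper integral is an infimum over measurable majorants \<open>g\<close> of
    the squared error, so each of them is bounded below. Integrating \<open>g\<close> avoids any
    measurability of the encoders.\<close>
  have bound: "ennreal (1 / 20) \<le> integral\<^sup>N (lebesgue_on Omega) g"
    if n: "1 \<le> n" "n \<le> CARD('p) * CARD('l) - 1"
      and h: "h1 \<in> UNIV \<rightarrow> carrier_vec n" "h2 \<in> UNIV \<rightarrow> carrier_vec n"
      and g: "g \<in> borel_measurable (lebesgue_on Omega)"
      and le: "\<And>X Y. (X, Y) \<in> Omega \<Longrightarrow>
        ennreal ((scalar_prod (h1 X) (h2 Y) - s (X, Y))\<^sup>2) \<le> g (X, Y)"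
    for n and h1 h2 :: "real ^ 'l ^ 'p \<Rightarrow> real Matrix.vec" and g
  proof -
    \<comment> \<open>Extending \<open>g\<close> by zero to the whole space allows translation in
      \<open>lebesgue\<close>.\<close>
    define G where "G z = g z * indicator Omega z" for z
    define I where "I = (\<integral>\<^sup>+ z. G z \<partial>lebesgue)"
    have int_g: "integral\<^sup>N (lebesgue_on Omega) g = I"
      unfolding I_def G_def by (rule nn_integral_restrict_space) (simp add: Omega)
    have G: "G \<in> borel_measurable lebesgue"
      using g borel_measurable_restrict_space_iff_ennreal[of Omega lebesgue g]
      by (simp add: Omega G_def[abs_def])
    have nN: "n < DIM(real ^ 'l ^ 'p)"
      using n by simp
    have "ennreal ((K * e)\<^sup>2) \<le> (\<Sum>(a, b)\<in>Basis \<times> Basis. G (((1 / 2) *\<^sub>R a, (1 / 2) *\<^sub>R b) + z))"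
      if "z \<in> B \<times> B" for z
    proof -
      obtain u w where z: "z = (u, w)" and u: "u \<in> B" and w: "w \<in> B"
        using \<open>z \<in> B \<times> B\<close> by auto
      let ?x = "\<lambda>a. (1 / 2) *\<^sub>R a + u" and ?y = "\<lambda>b. (1 / 2) *\<^sub>R b + w"
      \<comment> \<open>\<open>scalar_prod\<close> sums over the dimension of its second argument,
        here \<open>n\<close>; this exhibits the rank bound.\<close>
      have sp: "scalar_prod (h1 X) (h2 Y) = (\<Sum>k<n. vec_index (h1 X) k * vec_index (h2 Y) k)" for X Y
      proof -
        have "dim_vec (h2 Y) = n"
          using h(2) by (metis PiE UNIV_I carrier_vecD)
        then show ?thesis
          by (simp only: scalar_prod_def lessThan_atLeast0)
      qed
      note pert = inner_perturbed_Basis[OF N_def _ _ u[unfolded B_def \<eta>_def] w[unfolded B_def \<eta>_def]]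
      have "\<exists>a\<in>Basis. \<exists>b\<in>Basis. K * e \<le>
          \<bar>(\<Sum>k<n. vec_index (h1 (?x a)) k * vec_index (h2 (?y b)) k) - K * inner (?x a) (?y b)\<bar>"
      \<comment> \<open>For fixed \<open>(u, w)\<close> the grid values of \<open>s\<close> form the
        dominant matrix, with both thresholds scaled by \<open>K\<close>.\<close>
      proof (rule low_rank_far_from_diagonally_dominant[OF nN, where d = "K / 4"])
        show "K * e > 0"
          using K0 e0 by simp
        show "2 * real DIM(real ^ 'l ^ 'p) * (K * e) \<le> K / 4"
          unfolding N_def[symmetric] e_def using K0 N1 by simp
        show "K / 4 \<le> K * inner (?x b) (?y b)" if "b \<in> Basis" for b
          using mult_left_mono[OF pert(1)[OF that that], of K] K0 by simp
        show "\<bar>K * inner (?x a) (?y b)\<bar> \<le> K * e" if "a \<in> Basis" "b \<in> Basis" "a \<noteq> b" for a b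
          using mult_left_mono[OF pert(2)[OF that], of K] K0 by (simp add: abs_mult e_def)
      qed
      then obtain a b where ab: "a \<in> Basis" "b \<in> Basis"
        and far: "K * e \<le> \<bar>scalar_prod (h1 (?x a)) (h2 (?y b)) - s (?x a, ?y b)\<bar>"
        by (auto simp: sp s_def)
      have mem: "(?x a, ?y b) \<in> Omega"
        using half_mem ab u w by (simp add: Omega_def)
      have "(K * e)\<^sup>2 \<le> (scalar_prod (h1 (?x a)) (h2 (?y b)) - s (?x a, ?y b))\<^sup>2"
        using power_mono[OF far, of 2] K0 e0 by simp
      then have "ennreal ((K * e)\<^sup>2) \<le> g (?x a, ?y b)"
        using le[OF mem] by (meson ennreal_leI order_trans)
      also have "\<dots> = (\<lambda>(a, b). G (((1 / 2) *\<^sub>R a, (1 / 2) *\<^sub>R b) + z)) (a, b)"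
        using mem by (simp add: G_def z)
      \<comment> \<open>The bad grid point may vary with \<open>z\<close>; passing to the sum over
        all grid points removes this dependence.\<close>
      also have "\<dots> \<le> (\<Sum>(a, b)\<in>Basis \<times> Basis. G (((1 / 2) *\<^sub>R a, (1 / 2) *\<^sub>R b) + z))"
        by (rule member_le_sum) (use ab in auto)
      finally show ?thesis .
    qed
    then have "ennreal ((K * e)\<^sup>2) * emeasure lebesgue (B \<times> B)
        \<le> of_nat (card ((Basis :: (real ^ 'l ^ 'p) set) \<times> (Basis :: (real ^ 'l ^ 'p) set))) * I"
      unfolding I_def
      by (intro emeasure_le_nn_integral_translates[OF G BB_sets,
            where t = "\<lambda>(a, b). ((1 / 2) *\<^sub>R a, (1 / 2) *\<^sub>R b)"]) (simp add: case_prod_beta)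
    also have "of_nat (card ((Basis :: (real ^ 'l ^ 'p) set) \<times> (Basis :: (real ^ 'l ^ 'p) set)))
        = ennreal (N\<^sup>2)"
      by (simp only: card_cartesian_product N_def ennreal_of_nat_eq_real_of_nat of_nat_mult power2_eq_square)
    also have "ennreal ((K * e)\<^sup>2) * emeasure lebesgue (B \<times> B) = ennreal (N\<^sup>2) * 1"
      unfolding v using K v0 by (simp add: ennreal_mult[symmetric])
    \<comment> \<open>The positive finite factor \<open>N\<^sup>2\<close> cancels. The resulting
      bound 1 is stronger than the required \<open>1 / 20\<close>; a larger \<open>K\<close> would
      give any other constant.\<close>
    finally have "1 \<le> I"
      using N1 by (subst (asm) ennreal_mult_le_mult_iff) auto
    then show ?thesis
      unfolding int_g by (rule order_trans[rotated]) simp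
  qed
  show ?thesis
    unfolding upper_nn_integral_def
  proof (intro exI[of _ s] conjI cont allI impI INF_greatest)
    fix n and h1 h2 :: "real ^ 'l ^ 'p \<Rightarrow> real Matrix.vec" and g
    assume "1 \<le> n" "n \<le> CARD('p) * CARD('l) - 1" "h1 \<in> UNIV \<rightarrow> carrier_vec n" "h2 \<in> UNIV \<rightarrow> carrier_vec n"
      and "g \<in> {g \<in> borel_measurable (lebesgue_on Omega). \<forall>x\<in>space (lebesgue_on Omega).
        (case x of (X, Y) \<Rightarrow> ennreal ((scalar_prod (h1 X) (h2 Y) - s (X, Y))\<^sup>2)) \<le> g x}"
    then show "ennreal (1 / 20) \<le> integral\<^sup>N (lebesgue_on Omega) g"
      by (intro bound[of n h1 h2 g]) auto
  qed
qed

end
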